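(* Let $A\in\mathbb{R}^{n\times n}$ be symmetric positive definite with smallest and largest eigenvalues $\ell$ and $L$, let $b\in\mathbb{R}^n$, and let $f(x)=x^TAx/2-b^Tx$ with minimizer $x^*$. Let $x_k$ be the iterates of linear conjugate gradient (CG) applied to $f$ from an arbitrary $x_0$, and let $y_k,\tilde\sigma_k$ be the auxiliary quantities defined in the context from these iterates. Then for each $k=0,1,2,\ldots$, $$\|x^*-y_k\|^2+\frac{2(f(x_k)-f(x^* ))}{\ell}\le\tilde\sigma_k^2 .$$
   Context: Linear conjugate gradient (CG): $x_0$ is arbitrary; $r_0:=b-Ax_0$; $p_1:=r_0$; for $k=1,2,\ldots$: $\alpha_k:=\dfrac{r_{k-1}^Tr_{k-1}}{p_k^TAp_k}$; $x_k:=x_{k-1}+\alpha_kp_k$; $r_k:=r_{k-1}-\alpha_kAp_k$; $\beta_{k+1}:=\dfrac{r_k^Tr_k}{r_{k-1}^Tr_{k-1}}$; $p_{k+1}:=\beta_{k+1}p_k+r_k$. CG stops when the residual vanishes, so the index $k$ ranges over iterations that are performed (iteration $k\ge1$ requires $r_{k-1}\ne0$). Auxiliary quantities: $y_0:=x_0$, $\tilde\sigma_0:=\sqrt2\,\|\nabla f(x_0)\|/\ell$. For $k=1,2,\ldots$, let $\bar{\bar x}_{k-1}:=x_{k-1}-\nabla f(x_{k-1})/\ell$, $\tilde\rho_{k-1}:=\|\nabla f(x_{k-1})\|/\ell$, and $\gamma_j:=2(f(x_j)-f(x^* ))/\ell$ (so $\gamma_k-\gamma_{k-1}=2(f(x_k)-f(x_{k-1}))/\ell$).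 - If $\tilde\sigma_{k-1}^2\le2\tilde\rho_{k-1}^2$: let $\delta_{k-1}:=\|y_{k-1}-\bar{\bar x}_{k-1}\|$, $$\lambda_k:=\frac{\delta_{k-1}^2+\tilde\rho_{k-1}^2-\tilde\sigma_{k-1}^2}{2\delta_{k-1}^2},\qquad \tilde\xi_k^*:=\frac12\sqrt{2\tilde\rho_{k-1}^2+2\tilde\sigma_{k-1}^2-\delta_{k-1}^2-\frac{(\tilde\rho_{k-1}^2-\tilde\sigma_{k-1}^2)^2}{\delta_{k-1}^2}},$$ and $\tilde\sigma_k:=\sqrt{(\tilde\xi_k^* )^2-\gamma_{k-1}+\gamma_k}$. - Otherwise: $\lambda_k:=0$ and $\tilde\sigma_k:=\sqrt{\tilde\rho_{k-1}^2-\gamma_{k-1}+\gamma_k}$. In both cases $y_k:=(1-\lambda_k)\bar{\bar x}_{k-1}+\lambda_ky_{k-1}$. *)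

theory Defs
  imports "HOL-Analysis.Analysis"
begin

definition positive_definite :: "real^'n^'n \<Rightarrow> bool" where
  "positive_definite A \<longleftrightarrow> (\<forall>v. v \<noteq> 0 \<longrightarrow> v \<bullet> (A *v v) > 0)"

definition eigenvalue :: "real^'n^'n \<Rightarrow> real \<Rightarrow> bool" where
  "eigenvalue A c \<longleftrightarrow> (\<exists>v. v \<noteq> 0 \<and> A *v v = c *\<^sub>R v)"

definition smallest_eigenvalue :: "real^'n^'n \<Rightarrow> real \<Rightarrow> bool" where
  "smallest_eigenvalue A c \<longleftrightarrow> eigenvalue A c \<and> (\<forall>d. eigenvalue A d \<longrightarrow> c \<le> d)"

definition largest_eigenvalue :: "real^'n^'n \<Rightarrow> real \<Rightarrow> bool" where
  "largest_eigenvalue A c \<longleftrightarrow> eigenvalue A c \<and> (\<forall>d. eigenvalue A d \<longrightarrow> d \<le> c)"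

definition gradient :: "('a::real_inner \<Rightarrow> real) \<Rightarrow> 'a \<Rightarrow> 'a" where
  "gradient f x = (THE g. GDERIV f x :> g)"

(* cg_state A b x0 k = (x_k, r_k, p_{k+1}).  After the residual vanishes, the HOL
   convention t / 0 = 0 makes the recursion stay at the same point with r = p = 0;
   those indices are excluded by cg_performed. *)
primrec cg_state ::
  "real^'n^'n \<Rightarrow> real^'n \<Rightarrow> real^'n \<Rightarrow> nat \<Rightarrow> (real^'n) \<times> (real^'n) \<times> (real^'n)" where
  "cg_state A b x0 0 = (x0, b - A *v x0, b - A *v x0)"
| "cg_state A b x0 (Suc k) =
    (let (x, r, p) = cg_state A b x0 k;
         \<alpha> = (r \<bullet> r) / (p \<bullet> (A *v p));
         x' = x + \<alpha> *\<^sub>R p;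
         r' = r - \<alpha> *\<^sub>R (A *v p);
         \<beta> = (r' \<bullet> r') / (r \<bullet> r)
     in (x', r', \<beta> *\<^sub>R p + r'))"

definition cg_iterate :: "real^'n^'n \<Rightarrow> real^'n \<Rightarrow> real^'n \<Rightarrow> nat \<Rightarrow> real^'n" where
  "cg_iterate A b x0 k = fst (cg_state A b x0 k)"

definition cg_residual :: "real^'n^'n \<Rightarrow> real^'n \<Rightarrow> real^'n \<Rightarrow> nat \<Rightarrow> real^'n" where
  "cg_residual A b x0 k = fst (snd (cg_state A b x0 k))"

(* Iterations 1, ..., k are all performed; x_k itself may be the exact solution. *)
definition cg_performed :: "real^'n^'n \<Rightarrow> real^'n \<Rightarrow> real^'n \<Rightarrow> nat \<Rightarrow> bool" where
  "cg_performed A b x0 k \<longleftrightarrow> (\<forall>j<k. cg_residual A b x0 j \<noteq> 0)"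

(* aux_state f l xs x k = (y_k, sigma_k), where xs is the minimizer of f and x the
   sequence of iterates; xbb is the end point of a gradient step of length 1/l from x k.
   For performed CG iterations, division by \<delta> = 0 and square roots of negative numbers
   do not occur: y - x k is orthogonal to the gradient at x k, which gives \<delta> \<ge> \<rho> > 0,
   and the minimizer lies in both balls (centers y and xbb, radii \<sigma> and \<rho>). *)
primrec aux_state ::
  "('a::real_inner \<Rightarrow> real) \<Rightarrow> real \<Rightarrow> 'a \<Rightarrow> (nat \<Rightarrow> 'a) \<Rightarrow> nat \<Rightarrow> 'a \<times> real" where
  "aux_state f l xs x 0 = (x 0, sqrt 2 * norm (gradient f (x 0)) / l)"
| "aux_state f l xs x (Suc k) =
    (let (y, \<sigma>) = aux_state f l xs x k;
         xbb = x k - gradient f (x k) /\<^sub>R l;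
         \<rho> = norm (gradient f (x k)) / l;
         \<gamma> = (\<lambda>j. 2 * (f (x j) - f xs) / l);
         \<delta> = norm (y - xbb);
         \<xi> = 1/2 * sqrt (2 * \<rho>\<^sup>2 + 2 * \<sigma>\<^sup>2 - \<delta>\<^sup>2 - (\<rho>\<^sup>2 - \<sigma>\<^sup>2)\<^sup>2 / \<delta>\<^sup>2);
         (lam, \<sigma>') =
           (if \<sigma>\<^sup>2 \<le> 2 * \<rho>\<^sup>2
            then ((\<delta>\<^sup>2 + \<rho>\<^sup>2 - \<sigma>\<^sup>2) / (2 * \<delta>\<^sup>2), sqrt (\<xi>\<^sup>2 - \<gamma> k + \<gamma> (Suc k)))
            else (0, sqrt (\<rho>\<^sup>2 - \<gamma> k + \<gamma> (Suc k))))
     in ((1 - lam) *\<^sub>R xbb + lam *\<^sub>R y, \<sigma>'))"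

definition aux_center :: "('a::real_inner \<Rightarrow> real) \<Rightarrow> real \<Rightarrow> 'a \<Rightarrow> (nat \<Rightarrow> 'a) \<Rightarrow> nat \<Rightarrow> 'a" where
  "aux_center f l xs x k = fst (aux_state f l xs x k)"

definition aux_radius :: "('a::real_inner \<Rightarrow> real) \<Rightarrow> real \<Rightarrow> 'a \<Rightarrow> (nat \<Rightarrow> 'a) \<Rightarrow> nat \<Rightarrow> real" where
  "aux_radius f l xs x k = snd (aux_state f l xs x k)"

end

theory Submission
  imports Defs
begin

text \<open>
  Strong convexity puts the minimizer in the ball around the end point of a gradient step of
  length \<open>1/l\<close>, with squared radius reduced by the current gap \<open>\<gamma>\<close>; inductively it also lies in
  such a ball around \<open>y\<close>. The identity
  \<open>|z - ((1 - t) u + t v)|\<^sup>2 = (1 - t) |z - u|\<^sup>2 + t |z - v|\<^sup>2 - t (1 - t) |u - v|\<^sup>2\<close> then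
  yields a ball containing the intersection, and the chosen \<open>\<lambda>\<close> minimizes its radius. For the
  weights to lie in \<open>[0, 1]\<close> one needs \<open>\<delta> \<ge> \<rho>\<close>, which follows because \<open>y - x\<close> lies in the span
  of the previous CG directions and is therefore orthogonal to the current residual.
\<close>

section \<open>Symmetric matrices\<close>

lemma symmetric_inner:
  fixes A :: "real^'n^'n"
  assumes "transpose A = A"
  shows "u \<bullet> (A *v v) = (A *v u) \<bullet> v"
  using dot_lmul_matrix[of u A v] assms by (metis transpose_matrix_vector)

text \<open>First-order optimality in one variable: a nonzero linear term beats the quadratic one at
  a suitable \<open>t\<close>.\<close>

lemma linear_coeff_zero:
  fixes c d :: real
  assumes "\<And>t. 0 \<le> 2 * t * c + t\<^sup>2 * d"
  shows "c = 0"
proof (rule ccontr)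
  assume "c \<noteq> 0"
  have d: "d \<ge> 0"
    using assms[of 1] assms[of "-1"] by simp
  \<comment> \<open>The exact minimizer would be \<open>- c / d\<close>; adding 1 to the denominator
    covers \<open>d = 0\<close> and still gives a negative value.\<close>
  define t where "t = - c / (d + 1)"
  have c: "c = - t * (d + 1)" and t: "t \<noteq> 0"
    using d \<open>c \<noteq> 0\<close> by (auto simp: t_def field_simps)
  have "2 * t * c + t\<^sup>2 * d = - (t\<^sup>2 * (d + 2))"
    unfolding c by (simp add: algebra_simps power2_eq_square)
  moreover have "t\<^sup>2 * (d + 2) > 0"
    using t d by (intro mult_pos_pos) auto
  ultimately show False
    using assms[of t] by linarith
qed

text \<open>Moving from \<open>v\<close> along the defect \<open>w = A *v v - b\<close> changes the
  objective by \<open>t * (w \<bullet> w)\<close> to first order, so minimality forces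
  \<open>w = 0\<close>. It serves twice: for the CG objective, and with \<open>b = 0\<close> for a
  shifted matrix in the eigenvalue bound below.\<close>

lemma quadratic_minimizer_critical:
  fixes A :: "real^'n^'n"
  assumes sym: "transpose A = A"
    and min: "\<And>x. v \<bullet> (A *v v) / 2 - b \<bullet> v \<le> x \<bullet> (A *v x) / 2 - b \<bullet> x"
  shows "A *v v = b"
proof -
  define w where "w = A *v v - b"
  have "w \<bullet> w = 0"
  proof (rule linear_coeff_zero)
    fix t
    have "(v + t *\<^sub>R w) \<bullet> (A *v (v + t *\<^sub>R w))
        = v \<bullet> (A *v v) + 2 * t * (w \<bullet> (A *v v)) + t\<^sup>2 * (w \<bullet> (A *v w))"
      using symmetric_inner[OF sym, of v w]
      by (simp add: matrix_vector_right_distrib matrix_vector_mult_scaleR inner_add_left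
          inner_add_right power2_eq_square inner_commute algebra_simps)
    moreover have "w \<bullet> (A *v v) = w \<bullet> w + b \<bullet> w"
      by (simp add: w_def inner_diff_right inner_diff_left inner_commute)
    ultimately show "0 \<le> 2 * t * (w \<bullet> w) + t\<^sup>2 * (w \<bullet> (A *v w))"
      using min[of "v + t *\<^sub>R w"] by (simp add: inner_add_right power2_eq_square field_simps)
  qed
  then show ?thesis
    by (simp add: w_def)
qed

text \<open>By compactness the quadratic form attains its minimum on the unit sphere. A minimizer is
  an eigenvector whose eigenvalue is the minimum value, which is therefore at least
  \<open>l\<close>.\<close>

lemma smallest_eigenvalue_le_rayleigh:
  fixes A :: "real^'n^'n"
  assumes sym: "transpose A = A" and l: "smallest_eigenvalue A l"
  shows "l * (v \<bullet> v) \<le> v \<bullet> (A *v v)"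
proof -
  define q where "q u = u \<bullet> (A *v u)" for u
  have "continuous_on (sphere 0 1) q"
    unfolding q_def
    by (intro continuous_intros linear_continuous_on_compose[OF _ matrix_vector_mul_linear])
  moreover have "sphere (0::real^'n) 1 \<noteq> {}"
    by simp
  ultimately obtain u where u: "u \<in> sphere 0 1" and umin: "\<And>w. w \<in> sphere 0 1 \<Longrightarrow> q u \<le> q w"
    using continuous_attains_inf[OF compact_sphere] by blast
  have norm_u: "norm u = 1"
    using u by simp
  have q_ge: "q u * (w \<bullet> w) \<le> q w" for w
  proof (cases "w = 0")
    case False
    have "q u \<le> q (w /\<^sub>R norm w)"
      using False by (intro umin) simp
    also have "\<dots> = q w / (w \<bullet> w)"
      by (simp add: q_def matrix_vector_mult_scaleR dot_square_norm power2_eq_square field_simps)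
    finally show ?thesis
      using False by (simp add: pos_le_divide_eq)
  qed (simp add: q_def)
  \<comment> \<open>Shifting by the minimum value turns the constrained minimizer \<open>u\<close>
    into a global minimizer of the form of \<open>B\<close>, so no Lagrange multiplier is needed:
    criticality says \<open>B *v u = 0\<close>.\<close>
  define B where "B = A - q u *\<^sub>R mat 1"
  have B: "B *v w = A *v w - q u *\<^sub>R w" for w
    by (simp add: B_def matrix_vector_mult_diff_rdistrib scaleR_matrix_vector_assoc[symmetric])
  have symB: "transpose B = B"
    using sym by (simp add: B_def vec_eq_iff transpose_def mat_def)
  have "B *v u = 0"
  proof (rule quadratic_minimizer_critical[OF symB])
    fix w
    show "u \<bullet> (B *v u) / 2 - 0 \<bullet> u \<le> w \<bullet> (B *v w) / 2 - 0 \<bullet> w"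
      using q_ge[of w] norm_u
      by (simp add: B inner_diff_right flip: q_def) (simp add: dot_square_norm)
  qed
  then have "eigenvalue A (q u)"
    unfolding eigenvalue_def using norm_u by (intro exI[of _ u]) (auto simp: B)
  then have "l \<le> q u"
    using l by (simp add: smallest_eigenvalue_def)
  then have "l * (v \<bullet> v) \<le> q u * (v \<bullet> v)"
    by (rule mult_right_mono) simp
  then show ?thesis
    using q_ge[of v] by (simp add: q_def)
qed

section \<open>Gradients, in particular that of the quadratic objective\<close>

lemma gradient_eqI:
  assumes "GDERIV f x :> g"
  shows "gradient f x = g"
  unfolding gradient_def
proof (rule the_equality)
  show "h = g" if "GDERIV f x :> h" for h
  proof -
    have "(\<lambda>u. u \<bullet> h) = (\<lambda>u. u \<bullet> g)"
      using that assms unfolding gderiv_def by (rule has_derivative_unique)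
    then have "(h - g) \<bullet> h = (h - g) \<bullet> g"
      by (rule fun_cong)
    then have "(h - g) \<bullet> (h - g) = 0"
      by (simp add: inner_diff_right)
    then show ?thesis
      by simp
  qed
qed (fact assms)

lemma gradient_quadratic:
  fixes A :: "real^'n^'n"
  assumes sym: "transpose A = A"
  shows "gradient (\<lambda>x. x \<bullet> (A *v x) / 2 - b \<bullet> x) x = A *v x - b"
proof (rule gradient_eqI)
  have A: "((*v) A has_derivative (*v) A) (at x)"
    by (intro linear_imp_has_derivative matrix_vector_mul_linear)
  show "GDERIV (\<lambda>x. x \<bullet> (A *v x) / 2 - b \<bullet> x) x :> A *v x - b"
    unfolding gderiv_def
  proof (rule has_derivative_eq_rhs[OF has_derivative_diff])
    show "((\<lambda>x. x \<bullet> (A *v x) / 2) has_derivative (\<lambda>h. (x \<bullet> (A *v h) + h \<bullet> (A *v x)) / 2)) (at x)"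
      by (intro bounded_linear.has_derivative[OF bounded_linear_divide] has_derivative_inner
          has_derivative_ident A)
    show "((\<bullet>) b has_derivative (\<bullet>) b) (at x)"
      by (intro bounded_linear_imp_has_derivative bounded_linear_inner_right)
  qed (simp add: fun_eq_iff symmetric_inner[OF sym, of x] inner_diff_right inner_commute)
qed

section \<open>Orthogonality in conjugate gradients\<close>

text \<open>The index is shifted: the state at \<open>k\<close> stores the direction of iteration
  \<open>k + 1\<close>, so \<open>cg_direction\<close> and \<open>cg_step\<close> at
  \<open>k\<close> lead from iterate \<open>k\<close> to iterate \<open>k + 1\<close>.\<close>

definition cg_direction :: "real^'n^'n \<Rightarrow> real^'n \<Rightarrow> real^'n \<Rightarrow> nat \<Rightarrow> real^'n" where
  "cg_direction A b x0 k = snd (snd (cg_state A b x0 k))"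

definition cg_step :: "real^'n^'n \<Rightarrow> real^'n \<Rightarrow> real^'n \<Rightarrow> nat \<Rightarrow> real" where
  "cg_step A b x0 k = (cg_residual A b x0 k \<bullet> cg_residual A b x0 k) /
     (cg_direction A b x0 k \<bullet> (A *v cg_direction A b x0 k))"

lemma cg_0:
  "cg_iterate A b x0 0 = x0"
  "cg_residual A b x0 0 = b - A *v x0"
  "cg_direction A b x0 0 = b - A *v x0"
  by (simp_all add: cg_iterate_def cg_residual_def cg_direction_def)

lemma cg_Suc:
  "cg_iterate A b x0 (Suc k) = cg_iterate A b x0 k + cg_step A b x0 k *\<^sub>R cg_direction A b x0 k"
  "cg_residual A b x0 (Suc k) =
     cg_residual A b x0 k - cg_step A b x0 k *\<^sub>R (A *v cg_direction A b x0 k)"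
  "cg_direction A b x0 (Suc k) =
     ((cg_residual A b x0 (Suc k) \<bullet> cg_residual A b x0 (Suc k)) /
      (cg_residual A b x0 k \<bullet> cg_residual A b x0 k)) *\<^sub>R cg_direction A b x0 k
     + cg_residual A b x0 (Suc k)"
  by (simp_all add: cg_iterate_def cg_residual_def cg_direction_def cg_step_def Let_def
      split: prod.split)

text \<open>For performed iterations this is the Krylov space. It holds the displacements from
  \<open>x0\<close> of both the iterates and the centers \<open>y\<close>.\<close>

definition cg_space :: "real^'n^'n \<Rightarrow> real^'n \<Rightarrow> real^'n \<Rightarrow> nat \<Rightarrow> (real^'n) set" where
  "cg_space A b x0 k = span (cg_direction A b x0 ` {..<k})"

lemma subspace_cg_space: "subspace (cg_space A b x0 k)"
  by (simp add: cg_space_def)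

lemma cg_space_mono: "j \<le> k \<Longrightarrow> cg_space A b x0 j \<subseteq> cg_space A b x0 k"
  unfolding cg_space_def by (intro span_mono image_mono) auto

lemma cg_direction_in_space: "j < k \<Longrightarrow> cg_direction A b x0 j \<in> cg_space A b x0 k"
  unfolding cg_space_def by (intro span_base) auto

lemma cg_iterate_in_space: "cg_iterate A b x0 k - x0 \<in> cg_space A b x0 k"
proof (induction k)
  case 0
  show ?case
    by (simp add: cg_0 subspace_0 subspace_cg_space)
next
  case (Suc k)
  then have "(cg_iterate A b x0 k - x0) + cg_step A b x0 k *\<^sub>R cg_direction A b x0 k
      \<in> cg_space A b x0 (Suc k)"
    using cg_space_mono[of k "Suc k" A b x0]
    by (intro subspace_add subspace_scale subspace_cg_space cg_direction_in_space) auto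
  then show ?case
    by (simp add: cg_Suc(1) algebra_simps)
qed

text \<open>Solve the direction recurrence for the residual. The new direction itself occurs, hence
  the index \<open>Suc k\<close>.\<close>

lemma cg_residual_in_space: "cg_residual A b x0 k \<in> cg_space A b x0 (Suc k)"
proof (cases k)
  case 0
  then show ?thesis
    using cg_direction_in_space[of 0 "Suc 0" A b x0] by (simp add: cg_0)
next
  case (Suc j)
  define \<beta> where "\<beta> = (cg_residual A b x0 (Suc j) \<bullet> cg_residual A b x0 (Suc j)) /
      (cg_residual A b x0 j \<bullet> cg_residual A b x0 j)"
  have "cg_direction A b x0 k - \<beta> *\<^sub>R cg_direction A b x0 j \<in> cg_space A b x0 (Suc k)"
    using Suc by (intro subspace_diff subspace_scale subspace_cg_space cg_direction_in_space) auto
  then show ?thesis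
    using Suc by (simp add: cg_Suc(3) \<beta>_def)
qed

lemma cg_residual_eq: "cg_residual A b x0 k = b - A *v cg_iterate A b x0 k"
  by (induction k)
    (simp_all add: cg_0 cg_Suc matrix_vector_right_distrib matrix_vector_mult_scaleR)

text \<open>The claims support each other: conjugacy of the directions makes the next residual
  orthogonal to them, and orthogonal residuals with nonzero steps give the next conjugacy. The
  residual at \<open>k\<close> itself may vanish.\<close>

lemma cg_orthogonality:
  fixes A :: "real^'n^'n"
  assumes sym: "transpose A = A" and pd: "positive_definite A"
    and "cg_performed A b x0 k"
  shows "\<forall>j<k. cg_residual A b x0 k \<bullet> cg_direction A b x0 j = 0"
    and "\<forall>j<k. cg_direction A b x0 k \<bullet> (A *v cg_direction A b x0 j) = 0"
    and "cg_residual A b x0 k \<bullet> cg_direction A b x0 k = cg_residual A b x0 k \<bullet> cg_residual A b x0 k"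
    and "\<forall>j<k. cg_step A b x0 j \<noteq> 0"
  using assms(3)
proof (induction k)
  case 0
  {
    case 1 show ?case by simp
  next
    case 2 show ?case by simp
  next
    case 3 show ?case by (simp add: cg_0)
  next
    case 4 show ?case by simp
  }
next
  case (Suc k)
  define r where "r = cg_residual A b x0"
  define p where "p = cg_direction A b x0"
  define \<alpha> where "\<alpha> = cg_step A b x0"
  define \<beta> where "\<beta> = (r (Suc k) \<bullet> r (Suc k)) / (r k \<bullet> r k)"
  note r_Suc = cg_Suc(2)[of A b x0, folded r_def p_def \<alpha>_def]
  note p_Suc = cg_Suc(3)[of A b x0 k, folded r_def p_def, folded \<beta>_def]
  have main: "(\<forall>j<Suc k. r (Suc k) \<bullet> p j = 0) \<and> (\<forall>j<Suc k. p (Suc k) \<bullet> (A *v p j) = 0)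
      \<and> r (Suc k) \<bullet> p (Suc k) = r (Suc k) \<bullet> r (Suc k) \<and> (\<forall>j<Suc k. \<alpha> j \<noteq> 0)"
    if "cg_performed A b x0 (Suc k)"
  proof -
    have perf: "cg_performed A b x0 k" and rk: "r k \<noteq> 0"
      using that by (auto simp: cg_performed_def r_def)
    note IH = Suc.IH[OF perf, folded r_def p_def \<alpha>_def]
    \<comment> \<open>Otherwise \<open>r k \<bullet> p k\<close>, which equals
      \<open>r k \<bullet> r k\<close>, would vanish.\<close>
    have "p k \<noteq> 0"
      using IH(3) rk by auto
    then have pAp: "p k \<bullet> (A *v p k) > 0"
      using pd by (simp add: positive_definite_def)
    have \<alpha>k: "\<alpha> k = (r k \<bullet> r k) / (p k \<bullet> (A *v p k))"
      by (simp add: \<alpha>_def cg_step_def r_def p_def)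
    then have "\<alpha> k \<noteq> 0"
      using rk pAp by simp
    then have \<alpha>: "\<forall>j<Suc k. \<alpha> j \<noteq> 0"
      using IH(4) less_Suc_eq by auto
    \<comment> \<open>For \<open>j = k\<close> the step length is exactly the one that cancels this
      product; for \<open>j < k\<close> both terms vanish by the induction hypotheses.\<close>
    have rp: "r (Suc k) \<bullet> p j = 0" if "j < Suc k" for j
    proof (cases "j = k")
      case True
      then show ?thesis
        using IH(3) \<alpha>k pAp by (simp add: r_Suc inner_diff_left inner_commute[of "A *v p k"])
    next
      case False
      then have "j < k" using that by simp
      then show ?thesis
        using IH(1,2) by (simp add: r_Suc inner_diff_left flip: symmetric_inner[OF sym])
    qed
    have r_orth: "r (Suc k) \<bullet> r j = 0" if "j < Suc k" for j
    proof -
      have "r j \<in> span (p ` {..<Suc k})"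
        using cg_residual_in_space[of A b x0 j] cg_space_mono[of "Suc j" "Suc k" A b x0] that
        by (auto simp: cg_space_def r_def p_def)
      then have "orthogonal (r (Suc k)) (r j)"
        by (rule orthogonal_to_span) (auto simp: orthogonal_def rp)
      then show ?thesis
        by (simp add: orthogonal_def)
    qed
    \<comment> \<open>A nonzero step lets \<open>A *v p j\<close> be written through consecutive
      residuals. Conjugacy then follows from \<open>r_orth\<close>; only \<open>j = k\<close> leaves
      a term, and \<open>\<beta>\<close> is chosen to cancel it.\<close>
    have Ap: "A *v p j = (r j - r (Suc j)) /\<^sub>R \<alpha> j" if "j < Suc k" for j
      using \<alpha> that by (simp add: r_Suc)
    have pAp': "p (Suc k) \<bullet> (A *v p j) = 0" if j: "j < Suc k" for j
    proof (cases "j = k")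
      case True
      have "r (Suc k) \<bullet> (A *v p k) = - (r (Suc k) \<bullet> r (Suc k)) / \<alpha> k"
        using r_orth[of k] by (simp add: Ap inner_diff_right divide_inverse mult.commute)
      moreover have "\<beta> * (p k \<bullet> (A *v p k)) = (r (Suc k) \<bullet> r (Suc k)) / \<alpha> k"
        by (simp add: \<beta>_def \<alpha>k)
      ultimately show ?thesis
        by (simp add: True p_Suc inner_add_left)
    next
      case False
      then have "j < k" using j by simp
      then show ?thesis
        using IH(2) r_orth[of j] r_orth[of "Suc j"] by (simp add: p_Suc inner_add_left)
          (simp add: Ap inner_diff_right)
    qed
    show ?thesis
      using rp pAp' \<alpha> by (simp add: p_Suc inner_add_right)
  qed
  {
    case 1 then show ?case using main by (simp add: r_def p_def)
  next
    case 2 then show ?case using main by (simp add: p_def)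
  next
    case 3 then show ?case using main by (simp add: r_def p_def)
  next
    case 4 then show ?case using main by (simp add: \<alpha>_def)
  }
qed

lemma cg_residual_orthogonal_space:
  assumes "transpose A = A" "positive_definite A" "cg_performed A b x0 k"
    and "v \<in> cg_space A b x0 k"
  shows "v \<bullet> cg_residual A b x0 k = 0"
proof -
  have "orthogonal (cg_residual A b x0 k) v"
    using assms(4) unfolding cg_space_def
    by (rule orthogonal_to_span) (use cg_orthogonality(1)[OF assms(1-3)] in \<open>auto simp: orthogonal_def\<close>)
  then show ?thesis
    by (simp add: orthogonal_def inner_commute)
qed

section \<open>Combining balls\<close>

lemma norm_convex_combination_sq:
  fixes u v z :: "'a::real_inner"
  shows "(norm (z - ((1 - t) *\<^sub>R u + t *\<^sub>R v)))\<^sup>2 =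
    (1 - t) * (norm (z - u))\<^sup>2 + t * (norm (z - v))\<^sup>2 - t * (1 - t) * (norm (v - u))\<^sup>2"
  unfolding power2_norm_eq_inner
  by (simp add: inner_add_left inner_add_right inner_diff_left inner_diff_right inner_commute
      algebra_simps power2_eq_square)

text \<open>The offset \<open>c\<close> passes through unchanged because the weights sum to
  1.\<close>

lemma optimal_ball_intersection:
  fixes u v z :: "'a::real_inner"
  assumes u: "(norm (z - u))\<^sup>2 + c \<le> \<rho>\<^sup>2" and v: "(norm (z - v))\<^sup>2 + c \<le> \<sigma>\<^sup>2"
    and "c \<ge> 0" and \<delta>: "\<delta> = norm (v - u)" "\<delta> > 0"
    and "\<sigma>\<^sup>2 \<le> \<delta>\<^sup>2 + \<rho>\<^sup>2" "\<rho>\<^sup>2 \<le> \<delta>\<^sup>2 + \<sigma>\<^sup>2"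
    and t: "t = (\<delta>\<^sup>2 + \<rho>\<^sup>2 - \<sigma>\<^sup>2) / (2 * \<delta>\<^sup>2)"
    and \<xi>: "\<xi> = 1/2 * sqrt (2 * \<rho>\<^sup>2 + 2 * \<sigma>\<^sup>2 - \<delta>\<^sup>2 - (\<rho>\<^sup>2 - \<sigma>\<^sup>2)\<^sup>2 / \<delta>\<^sup>2)"
  shows "(norm (z - ((1 - t) *\<^sub>R u + t *\<^sub>R v)))\<^sup>2 + c \<le> \<xi>\<^sup>2"
proof -
  define w where "w = 2 * \<rho>\<^sup>2 + 2 * \<sigma>\<^sup>2 - \<delta>\<^sup>2 - (\<rho>\<^sup>2 - \<sigma>\<^sup>2)\<^sup>2 / \<delta>\<^sup>2"
  have d2: "\<delta>\<^sup>2 > 0" using \<delta> by simp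
  \<comment> \<open>The two assumptions comparing \<open>\<rho>\<close>, \<open>\<sigma>\<close> and
    \<open>\<delta>\<close> say exactly this.\<close>
  have t01: "0 \<le> t" "t \<le> 1"
    using assms d2 by (simp_all add: t field_simps)
  have "(norm (z - ((1 - t) *\<^sub>R u + t *\<^sub>R v)))\<^sup>2 + c =
      (1 - t) * ((norm (z - u))\<^sup>2 + c) + t * ((norm (z - v))\<^sup>2 + c) - t * (1 - t) * \<delta>\<^sup>2"
    unfolding norm_convex_combination_sq \<delta>(1) by (simp add: algebra_simps)
  also have "\<dots> \<le> (1 - t) * \<rho>\<^sup>2 + t * \<sigma>\<^sup>2 - t * (1 - t) * \<delta>\<^sup>2"
    using u v t01 by (intro diff_right_mono add_mono mult_left_mono) auto
  also have "\<dots> = \<rho>\<^sup>2 + t * (\<sigma>\<^sup>2 - \<rho>\<^sup>2 - \<delta>\<^sup>2) + t * (t * \<delta>\<^sup>2)"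
    by (simp add: algebra_simps)
  \<comment> \<open>At this \<open>t\<close> the quadratic in \<open>t\<close> reaches its minimum
    \<open>\<rho>\<^sup>2 - t\<^sup>2 * \<delta>\<^sup>2\<close>.\<close>
  also have "\<dots> = w / 4"
    using d2 unfolding t w_def by (simp add: field_simps) algebra
  finally have le: "(norm (z - ((1 - t) *\<^sub>R u + t *\<^sub>R v)))\<^sup>2 + c \<le> w / 4" .
  \<comment> \<open>The point \<open>z\<close> witnesses that the radicand is nonnegative; for a
    negative \<open>w\<close>, squaring the HOL square root would give its absolute value.\<close>
  moreover have "0 \<le> w"
    using le \<open>c \<ge> 0\<close> zero_le_power2[of "norm (z - ((1 - t) *\<^sub>R u + t *\<^sub>R v))"] by linarith
  then have "\<xi>\<^sup>2 = w / 4"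
    by (simp add: \<xi> power_mult_distrib power_divide flip: w_def)
  ultimately show ?thesis
    by simp
qed

text \<open>Completing the square: expanding around \<open>x\<close> produces the strong convexity
  bound scaled by \<open>2 / l\<close>, plus the squared length of the step.\<close>

lemma gradient_step_ball:
  fixes x z g :: "'a::real_inner"
  assumes "l > 0" and sc: "fx + g \<bullet> (z - x) + l / 2 * (norm (z - x))\<^sup>2 \<le> fz"
  shows "(norm (z - (x - g /\<^sub>R l)))\<^sup>2 + 2 * (fx - fz) / l \<le> (norm g / l)\<^sup>2"
proof -
  have "2 * fx / l + 2 * (g \<bullet> (z - x)) / l + (norm (z - x))\<^sup>2 =
      2 / l * (fx + g \<bullet> (z - x) + l / 2 * (norm (z - x))\<^sup>2)"
    using \<open>l > 0\<close> by (simp add: distrib_left)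
  also have "\<dots> \<le> 2 / l * fz"
    using sc \<open>l > 0\<close> by (intro mult_left_mono) auto
  finally have "2 * fx / l + 2 * (g \<bullet> (z - x)) / l + (norm (z - x))\<^sup>2 \<le> 2 / l * fz" .
  moreover have "z - (x - g /\<^sub>R l) = (z - x) + g /\<^sub>R l"
    by simp
  then have "(norm (z - (x - g /\<^sub>R l)))\<^sup>2 =
      (norm (z - x))\<^sup>2 + 2 * (g \<bullet> (z - x)) / l + (norm g / l)\<^sup>2"
    using \<open>l > 0\<close> unfolding power_divide power2_norm_eq_inner
    by (simp only: inner_add_left inner_add_right)
      (simp add: inner_commute power2_eq_square field_simps)
  ultimately show ?thesis
    by (simp add: right_diff_distrib diff_divide_distrib)
qed

text \<open>The induction over the balls for an abstract sequence. The CG method enters only through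
  \<open>nz\<close> and \<open>orth\<close>.\<close>

lemma aux_state_bound:
  fixes f :: "'a::real_inner \<Rightarrow> real"
  assumes l: "l > 0"
    and sc: "\<And>j. f (x j) + gradient f (x j) \<bullet> (xs - x j) + l / 2 * (norm (xs - x j))\<^sup>2 \<le> f xs"
    and growth: "\<And>j. f xs + l / 2 * (norm (xs - x j))\<^sup>2 \<le> f (x j)"
    and nz: "\<And>j. j < k \<Longrightarrow> gradient f (x j) \<noteq> 0"
    and orth: "\<And>j. j < k \<Longrightarrow> (aux_center f l xs x j - x j) \<bullet> gradient f (x j) = 0"
  shows "(norm (xs - aux_center f l xs x k))\<^sup>2 + 2 * (f (x k) - f xs) / l
    \<le> (aux_radius f l xs x k)\<^sup>2"
  using nz orth
proof (induction k)
  case 0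
  \<comment> \<open>The initial squared radius is twice the squared step length: one copy bounds the
    gap, and the other bounds the squared distance, which is at most the gap by
    \<open>growth\<close>.\<close>
  have "0 \<le> (norm (xs - (x 0 - gradient f (x 0) /\<^sub>R l)))\<^sup>2"
    by simp
  then have "2 * (f (x 0) - f xs) / l \<le> (norm (gradient f (x 0)) / l)\<^sup>2"
    using gradient_step_ball[OF l sc[of 0]] by linarith
  moreover have "(norm (xs - x 0))\<^sup>2 \<le> 2 * (f (x 0) - f xs) / l"
    using growth[of 0] l by (simp add: field_simps)
  ultimately show ?case
    by (simp add: aux_center_def aux_radius_def power_mult_distrib power_divide)
next
  case (Suc k)
  define g where "g = gradient f (x k)"
  define y where "y = aux_center f l xs x k"
  define \<sigma> where "\<sigma> = aux_radius f l xs x k"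
  define u where "u = x k - g /\<^sub>R l"
  define \<rho> where "\<rho> = norm g / l"
  define \<gamma> where "\<gamma> j = 2 * (f (x j) - f xs) / l" for j
  define \<delta> where "\<delta> = norm (y - u)"
  define \<xi> where "\<xi> = 1/2 * sqrt (2 * \<rho>\<^sup>2 + 2 * \<sigma>\<^sup>2 - \<delta>\<^sup>2 - (\<rho>\<^sup>2 - \<sigma>\<^sup>2)\<^sup>2 / \<delta>\<^sup>2)"
  define t where "t = (if \<sigma>\<^sup>2 \<le> 2 * \<rho>\<^sup>2 then (\<delta>\<^sup>2 + \<rho>\<^sup>2 - \<sigma>\<^sup>2) / (2 * \<delta>\<^sup>2) else 0)"
  \<comment> \<open>The squared radius before \<open>\<gamma> k\<close> is exchanged for
    \<open>\<gamma> (Suc k)\<close>; \<open>t\<close> and \<open>s\<close> treat both branches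
    uniformly.\<close>
  define s where "s = (if \<sigma>\<^sup>2 \<le> 2 * \<rho>\<^sup>2 then \<xi>\<^sup>2 else \<rho>\<^sup>2)"
  have state: "aux_state f l xs x k = (y, \<sigma>)"
    by (simp add: y_def \<sigma>_def aux_center_def aux_radius_def)
  have y_Suc: "aux_center f l xs x (Suc k) = (1 - t) *\<^sub>R u + t *\<^sub>R y"
    by (simp add: aux_center_def state Let_def t_def u_def g_def \<delta>_def \<rho>_def)
  have \<sigma>_Suc: "aux_radius f l xs x (Suc k) = sqrt (s - \<gamma> k + \<gamma> (Suc k))"
    by (simp add: aux_radius_def state Let_def s_def \<xi>_def u_def g_def \<delta>_def \<rho>_def \<gamma>_def)
  have \<gamma>_nonneg: "\<gamma> j \<ge> 0" for j
  proof -
    have "0 \<le> l / 2 * (norm (xs - x j))\<^sup>2"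
      using l by simp
    then have "f xs \<le> f (x j)"
      using growth[of j] by linarith
    then show ?thesis
      using l by (simp add: \<gamma>_def)
  qed
  have ball_u: "(norm (xs - u))\<^sup>2 + \<gamma> k \<le> \<rho>\<^sup>2"
    using gradient_step_ball[OF l sc[of k]] by (simp add: u_def g_def \<gamma>_def \<rho>_def)
  have ball_y: "(norm (xs - y))\<^sup>2 + \<gamma> k \<le> \<sigma>\<^sup>2"
    using Suc by (simp add: y_def \<sigma>_def \<gamma>_def)
  \<comment> \<open>Hence \<open>y - u\<close> is the hypotenuse of a right triangle with a leg of
    length \<open>\<rho>\<close>.\<close>
  have "(y - x k) \<bullet> g = 0"
    using Suc.prems(2)[of k] by (simp add: y_def g_def)
  then have "orthogonal (y - x k) (g /\<^sub>R l)"
    by (simp add: orthogonal_def)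
  then have "(norm ((y - x k) + g /\<^sub>R l))\<^sup>2 = (norm (y - x k))\<^sup>2 + (norm (g /\<^sub>R l))\<^sup>2"
    by (rule norm_add_Pythagorean)
  moreover have "(y - x k) + g /\<^sub>R l = y - u" "norm (g /\<^sub>R l) = \<rho>"
    using l by (simp_all add: u_def \<rho>_def divide_inverse mult.commute)
  ultimately have \<delta>_ge: "\<rho>\<^sup>2 \<le> \<delta>\<^sup>2"
    by (simp add: \<delta>_def)
  have "\<rho> > 0"
    using Suc.prems(1)[of k] l by (simp add: \<rho>_def g_def)
  then have "\<delta>\<^sup>2 > 0"
    using \<delta>_ge by (meson less_le_trans zero_less_power)
  then have "\<delta> > 0"
    by (simp add: \<delta>_def)
  have "(norm (xs - ((1 - t) *\<^sub>R u + t *\<^sub>R y)))\<^sup>2 + \<gamma> k \<le> s"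
  proof (cases "\<sigma>\<^sup>2 \<le> 2 * \<rho>\<^sup>2")
    case True
    have "(norm (xs - ((1 - t) *\<^sub>R u + t *\<^sub>R y)))\<^sup>2 + \<gamma> k \<le> \<xi>\<^sup>2"
    proof (rule optimal_ball_intersection[OF ball_u ball_y \<gamma>_nonneg \<delta>_def \<open>\<delta> > 0\<close> _ _ _ \<xi>_def])
      \<comment> \<open>The branch condition enters here: \<open>\<sigma>\<^sup>2\<close> is at most
        \<open>2 * \<rho>\<^sup>2\<close>, and one copy of \<open>\<rho>\<^sup>2\<close> is at most
        \<open>\<delta>\<^sup>2\<close>.\<close>
      show "\<sigma>\<^sup>2 \<le> \<delta>\<^sup>2 + \<rho>\<^sup>2"
        using True \<delta>_ge by linarith
      show "\<rho>\<^sup>2 \<le> \<delta>\<^sup>2 + \<sigma>\<^sup>2"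
        using \<delta>_ge zero_le_power2[of \<sigma>] by linarith
    qed (simp add: t_def True)
    then show ?thesis
      by (simp add: s_def True)
  next
    case False
    then show ?thesis
      using ball_u by (simp add: t_def s_def)
  qed
  then have "(norm (xs - aux_center f l xs x (Suc k)))\<^sup>2 + \<gamma> (Suc k) \<le> s - \<gamma> k + \<gamma> (Suc k)"
    by (simp add: y_Suc)
  \<comment> \<open>The left side is nonnegative, so squaring the new radius returns the
    radicand.\<close>
  moreover from this have "0 \<le> s - \<gamma> k + \<gamma> (Suc k)"
    using \<gamma>_nonneg[of "Suc k"] zero_le_power2[of "norm (xs - aux_center f l xs x (Suc k))"]
    by linarith
  ultimately show ?case
    unfolding \<gamma>_def[symmetric] \<sigma>_Suc by simp
qed

text \<open>The new center is an affine combination of the old one and a gradient step, so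
  displacements from \<open>x0\<close> combine with the same weights. The residual in that step
  raises the index by one.\<close>

lemma aux_center_in_cg_space:
  assumes grad: "\<And>j. gradient f (cg_iterate A b x0 j) = - cg_residual A b x0 j"
  shows "aux_center f l xs (cg_iterate A b x0) k - x0 \<in> cg_space A b x0 k"
proof (induction k)
  case 0
  show ?case
    by (simp add: aux_center_def cg_0 subspace_0 subspace_cg_space)
next
  case (Suc k)
  define x where "x = cg_iterate A b x0"
  define r where "r = cg_residual A b x0"
  define y where "y = aux_center f l xs x k"
  \<comment> \<open>Membership holds for any weight, so both branches are covered at once.\<close>
  have "\<exists>t. aux_center f l xs x (Suc k) =
      (1 - t) *\<^sub>R (x k - gradient f (x k) /\<^sub>R l) + t *\<^sub>R y"
    unfolding y_def aux_center_def aux_state.simps Let_def case_prod_beta fst_conv by blast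
  then obtain t where t: "aux_center f l xs x (Suc k) =
      (1 - t) *\<^sub>R (x k - gradient f (x k) /\<^sub>R l) + t *\<^sub>R y" ..
  have "y - x0 \<in> cg_space A b x0 (Suc k)" "x k - x0 \<in> cg_space A b x0 (Suc k)"
    using Suc cg_iterate_in_space[of A b x0 k] cg_space_mono[of k "Suc k" A b x0]
    by (auto simp: y_def x_def)
  moreover have "r k \<in> cg_space A b x0 (Suc k)"
    unfolding r_def by (rule cg_residual_in_space)
  ultimately have "(1 - t) *\<^sub>R ((x k - x0) + r k /\<^sub>R l) + t *\<^sub>R (y - x0) \<in> cg_space A b x0 (Suc k)"
    by (intro subspace_add subspace_scale subspace_cg_space)
  also have "(1 - t) *\<^sub>R ((x k - x0) + r k /\<^sub>R l) + t *\<^sub>R (y - x0) = aux_center f l xs x (Suc k) - x0"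
    unfolding t by (simp add: grad x_def r_def algebra_simps)
  finally show ?case
    by (simp add: x_def)
qed

theorem theorem8:
  fixes A :: "real^'n^'n" and b x0 xs :: "real^'n"
    and l L :: real and f :: "real^'n \<Rightarrow> real" and k :: nat
  assumes "transpose A = A"
    and "positive_definite A"
    and "smallest_eigenvalue A l"
    and "largest_eigenvalue A L"
    and "f = (\<lambda>x. (x \<bullet> (A *v x)) / 2 - b \<bullet> x)"
    and "is_arg_min f (\<lambda>_. True) xs"
    and "cg_performed A b x0 k"
  shows "(norm (xs - aux_center f l xs (cg_iterate A b x0) k))\<^sup>2
           + 2 * (f (cg_iterate A b x0 k) - f xs) / l
         \<le> (aux_radius f l xs (cg_iterate A b x0) k)\<^sup>2"
proof (rule aux_state_bound)
  note sym = assms(1)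
  obtain v where v: "v \<noteq> 0" "A *v v = l *\<^sub>R v"
    using assms(3) by (auto simp: smallest_eigenvalue_def eigenvalue_def)
  \<comment> \<open>Positive definiteness is tested on the eigenvector of \<open>l\<close>.\<close>
  then have "0 < l * (v \<bullet> v)"
    using assms(2) unfolding positive_definite_def by fastforce
  then show "l > 0"
    by (rule zero_less_mult_pos2) (simp add: v(1))
  have b: "b = A *v xs"
    using quadratic_minimizer_critical[OF sym, of xs b] assms(5,6)
    by (simp add: is_arg_min_def not_less)
  have grad: "gradient f x = A *v x - b" for x
    unfolding assms(5) by (rule gradient_quadratic[OF sym])
  \<comment> \<open>With \<open>b = A *v xs\<close> the gap is half the squared distance to
    \<open>xs\<close> in the \<open>A\<close>-norm. Growth and strong convexity then both reduce to
    the Rayleigh bound.\<close>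
  have gap: "f x - f xs = (xs - x) \<bullet> (A *v (xs - x)) / 2" for x
    using symmetric_inner[OF sym, of xs x]
    by (simp add: assms(5) b matrix_vector_mult_diff_distrib inner_diff_left inner_diff_right
        inner_commute field_simps)
  have rayleigh: "l * (norm v)\<^sup>2 \<le> v \<bullet> (A *v v)" for v
    using smallest_eigenvalue_le_rayleigh[OF sym assms(3)] by (simp add: power2_norm_eq_inner)
  fix j
  let ?x = "cg_iterate A b x0"
  show "f xs + l / 2 * (norm (xs - ?x j))\<^sup>2 \<le> f (?x j)"
    using gap[of "?x j"] rayleigh[of "xs - ?x j"] by simp
  have "gradient f (?x j) = - (A *v (xs - ?x j))"
    by (simp add: grad b matrix_vector_mult_diff_distrib)
  then have "gradient f (?x j) \<bullet> (xs - ?x j) = - ((xs - ?x j) \<bullet> (A *v (xs - ?x j)))"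
    by (simp add: inner_commute)
  then show "f (?x j) + gradient f (?x j) \<bullet> (xs - ?x j) + l / 2 * (norm (xs - ?x j))\<^sup>2 \<le> f xs"
    using gap[of "?x j"] rayleigh[of "xs - ?x j"] by simp
  have grad_cg: "gradient f (?x i) = - cg_residual A b x0 i" for i
    by (simp add: grad cg_residual_eq)
  assume "j < k"
  then have perf: "cg_performed A b x0 j" and "cg_residual A b x0 j \<noteq> 0"
    using assms(7) by (auto simp: cg_performed_def)
  then show "gradient f (?x j) \<noteq> 0"
    by (simp add: grad_cg)
  \<comment> \<open>Both displacements lie in the space of the first \<open>j\<close> directions,
    which is orthogonal to the residual at \<open>j\<close>, the negative gradient.\<close>
  have "(aux_center f l xs ?x j - x0) - (?x j - x0) \<in> cg_space A b x0 j"
    by (intro subspace_diff subspace_cg_space aux_center_in_cg_space cg_iterate_in_space grad_cg)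
  then have "aux_center f l xs ?x j - ?x j \<in> cg_space A b x0 j"
    by simp
  then show "(aux_center f l xs ?x j - ?x j) \<bullet> gradient f (?x j) = 0"
    using cg_residual_orthogonal_space[OF sym assms(2) perf] by (simp add: grad_cg)
qed

end
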